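(* Let $N=pq$ be a product of two distinct odd primes, and let $\psi_1,\psi_2$ be integers with $\psi_1\equiv 1 \bmod p$, $\psi_1\equiv 0 \bmod q$, $\psi_2\equiv 0\bmod p$, $\psi_2\equiv 1\bmod q$. Let $m$ be an integer with $\gcd(m,N)=1$, and let $m_1=m \bmod p$, $m_2=m\bmod q$, so that $m\equiv m_1\psi_1+m_2\psi_2 \bmod N$. Define $$f_1=\frac{m_1}{2}\left[1-\left(\frac{m_1}{p}\right)\right]+\frac12\left[1+\left(\frac{m_1}{p}\right)\right],\qquad f_2=\frac{m_2}{2}\left[1-\left(\frac{m_2}{q}\right)\right]+\frac12\left[1+\left(\frac{m_2}{q}\right)\right],$$ where $\left(\frac{\cdot}{p}\right)$ and $\left(\frac{\cdot}{q}\right)$ are Legendre symbols. Then the equation $$x^2\equiv (m_1\psi_1+m_2\psi_2)(f_1\psi_1+f_2\psi_2) \equiv m_1f_1\psi_1+m_2f_2\psi_2 \bmod N$$ is solvable.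
   Context: This is the statement underlying a deterministic padding for Rabin signatures: $f_1\psi_1+f_2\psi_2$ multiplied by the message $m$ is a quadratic residue modulo $N$. *)

theory Defs
  imports "HOL-Number_Theory.Number_Theory"
begin

end

(* The padding factor f_1 is 1 if m_1 is a quadratic residue and m_1 otherwise, so m_1 f_1 is
   either the residue m_1 or the square m_1^2; likewise modulo q. The Chinese remainder theorem,
   with psi_1 and psi_2 as idempotents, glues the two square roots. *)
theory Submission
  imports Defs
begin

text \<open>Since \<open>a\<close> is nonzero modulo \<open>p\<close>, the symbol is 1 or -1, so one
  of the two summands of \<open>f\<close> vanishes and the other loses its factor 1/2. Thus
  \<open>f\<close> is an integer; the symbol 0 would leave (a + 1) / 2.\<close>

lemma Legendre_padding:
  fixes a p :: int and f :: rat
  assumes "\<not> [a = 0] (mod p)"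
    and f: "f = of_int a / 2 * (1 - of_int (Legendre a p)) + 1 / 2 * (1 + of_int (Legendre a p))"
  obtains F where "of_int F = f" and "QuadRes p (a * F)"
proof (cases "QuadRes p a")
  case True
  with assms have "of_int 1 = f"
    by (simp add: Legendre_def)
  moreover have "QuadRes p (a * 1)"
    using True by simp
  ultimately show ?thesis
    by (rule that)
next
  case False
  with assms have "of_int a = f"
    by (simp add: Legendre_def)
  moreover have "QuadRes p (a * a)"
    unfolding QuadRes_def by (metis cong_refl power2_eq_square)
  ultimately show ?thesis
    by (rule that)
qed

text \<open>Read modulo \<open>p\<close>, the pair \<open>e1\<close>, \<open>e2\<close> selects the
  first coefficient. Exchanging the two summands gives the same for \<open>q\<close> and the second
  coefficient.\<close>

lemma cong_idempotent_combination:
  fixes a b e1 e2 p :: int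
  assumes "[e1 = 1] (mod p)" and "[e2 = 0] (mod p)"
  shows "[a * e1 + b * e2 = a] (mod p)"
proof -
  have "[a * e1 + b * e2 = a * 1 + b * 0] (mod p)"
    using assms by (intro cong_add cong_mult cong_refl)
  then show ?thesis
    by simp
qed

theorem mainTheorem4:
  fixes p q N \<psi>1 \<psi>2 m m1 m2 :: int and f1 f2 :: rat
  assumes "prime p" and "odd p" and "prime q" and "odd q" and "p \<noteq> q"
    and "N = p * q"
    and "[\<psi>1 = 1] (mod p)" and "[\<psi>1 = 0] (mod q)"
    and "[\<psi>2 = 0] (mod p)" and "[\<psi>2 = 1] (mod q)"
    and "gcd m N = 1"
    and "m1 = m mod p" and "m2 = m mod q"
    and "f1 = of_int m1 / 2 * (1 - of_int (Legendre m1 p)) + 1 / 2 * (1 + of_int (Legendre m1 p))"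
    and "f2 = of_int m2 / 2 * (1 - of_int (Legendre m2 q)) + 1 / 2 * (1 + of_int (Legendre m2 q))"
  shows "[m = m1 * \<psi>1 + m2 * \<psi>2] (mod N) \<and>
    (\<exists>F1 F2 :: int. of_int F1 = f1 \<and> of_int F2 = f2 \<and>
       [(m1 * \<psi>1 + m2 * \<psi>2) * (F1 * \<psi>1 + F2 * \<psi>2) = m1 * F1 * \<psi>1 + m2 * F2 * \<psi>2] (mod N) \<and>
       (\<exists>x :: int. [x\<^sup>2 = (m1 * \<psi>1 + m2 * \<psi>2) * (F1 * \<psi>1 + F2 * \<psi>2)] (mod N)))"
proof -
  have "coprime p q"
    using assms(1,3,5) by (rule primes_coprime)
  then have cong_N: "[x = y] (mod N)" if "[x = y] (mod p)" "[x = y] (mod q)" for x y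
    using that coprime_cong_mult assms(6) by blast
  have comb_p: "[a * \<psi>1 + b * \<psi>2 = a] (mod p)" for a b
    using assms(7,9) by (rule cong_idempotent_combination)
  have comb_q: "[a * \<psi>1 + b * \<psi>2 = b] (mod q)" for a b
    using cong_idempotent_combination[OF assms(10,8), of b a] by (simp add: add.commute)
  \<comment> \<open>Coprimality to \<open>N\<close> makes both residues of \<open>m\<close> nonzero,
    which excludes the value 0 of the Legendre symbols.\<close>
  have "coprime m p" "coprime m q"
    using assms(6,11) by (auto simp: coprime_iff_gcd_eq_1[symmetric])
  then have "\<not> p dvd m" "\<not> q dvd m"
    using assms(1,3) by (meson coprime_common_divisor dvd_refl not_prime_unit)+
  then have "\<not> [m1 = 0] (mod p)" "\<not> [m2 = 0] (mod q)"
    using assms(12,13) by (auto simp: cong_def dvd_eq_mod_eq_0)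
  with assms(14,15) obtain F1 F2
    where F: "of_int F1 = f1" "of_int F2 = f2"
      and res: "QuadRes p (m1 * F1)" "QuadRes q (m2 * F2)"
    by (metis Legendre_padding)
  from res obtain y1 y2 where y: "[y1\<^sup>2 = m1 * F1] (mod p)" "[y2\<^sup>2 = m2 * F2] (mod q)"
    unfolding QuadRes_def by blast
  let ?P = "(m1 * \<psi>1 + m2 * \<psi>2) * (F1 * \<psi>1 + F2 * \<psi>2)"
  have P: "[?P = m1 * F1] (mod p)" "[?P = m2 * F2] (mod q)"
    by (intro cong_mult comb_p comb_q)+
  have "[m = m1 * \<psi>1 + m2 * \<psi>2] (mod N)"
  proof (rule cong_N)
    show "[m = m1 * \<psi>1 + m2 * \<psi>2] (mod p)"
      using comb_p[of m1 m2] assms(12) by (simp add: cong_def)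
    show "[m = m1 * \<psi>1 + m2 * \<psi>2] (mod q)"
      using comb_q[of m1 m2] assms(13) by (simp add: cong_def)
  qed
  \<comment> \<open>Both sides have residues \<open>m1 * F1\<close> modulo \<open>p\<close> and
    \<open>m2 * F2\<close> modulo \<open>q\<close>, so the product need not be expanded.\<close>
  moreover have "[?P = m1 * F1 * \<psi>1 + m2 * F2 * \<psi>2] (mod N)"
    using P comb_p comb_q by (meson cong_N cong_sym cong_trans)
  \<comment> \<open>The glued root reduces to \<open>y1\<close> modulo \<open>p\<close> and to
    \<open>y2\<close> modulo \<open>q\<close>, so its square matches \<open>?P\<close> at both
    primes.\<close>
  moreover have "[(y1 * \<psi>1 + y2 * \<psi>2)\<^sup>2 = ?P] (mod N)"
  proof (rule cong_N)
    show "[(y1 * \<psi>1 + y2 * \<psi>2)\<^sup>2 = ?P] (mod p)"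
      using cong_pow[OF comb_p] y(1) P(1) by (meson cong_sym cong_trans)
    show "[(y1 * \<psi>1 + y2 * \<psi>2)\<^sup>2 = ?P] (mod q)"
      using cong_pow[OF comb_q] y(2) P(2) by (meson cong_sym cong_trans)
  qed
  ultimately show ?thesis
    using F by blast
qed

end
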